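(* Let $p\ge2$. There are no atoms in the lattice $\mathbf{FS}$. For any $p$-ary groupoid $\mathbf{A}$ (so $\sigma(\mathbf{A})\in FS$): $\sigma(\mathbf{A})$ is a coatom in $\mathbf{FS}$ if and only if $s_n(\mathbf{A})=1$ for all $n\in\mathbb{N}\setminus\{2\}$ and $s_2(\mathbf{A})=2$.
   Context: $\mathbb{N}$ includes $0$; $p\ge 2$ is an integer. $T$ is the set of $p$-ary bracketings: terms (prefix notation) over the single variable $x$ and the $p$-ary operation symbol $\omega$, i.e. $x\in T$, and $\omega t_1\ldots t_p\in T$ whenever $t_1,\ldots,t_p\in T$. $|t|_\omega$ is the number of occurrences of $\omega$ in $t$; $B_n^{(p)}=\{t\in T:|t|_\omega=n\}$; $\Lambda^{(p)}=\{(s,t)\in T\times T:|s|_\omega=|t|_\omega\}$. A $p$-ary groupoid is an algebra with one $p$-ary operation. $\varepsilon_1(t)$ is the term obtained from $t$ by replacing the occurrences of $x$, from left to right, by distinct variables $x_1,x_2,\ldots$. The fine spectrum $\sigma(\mathbf{A})$ of a $p$-ary groupoid $\mathbf{A}$ is the set of all $(s,t)\in\Lambda^{(p)}$ such that $\mathbf{A}$ satisfies the identity $\varepsilon_1(s)\approx\varepsilon_1(t)$; $\sigma_n(\mathbf{A})=\sigma(\mathbf{A})\cap(B_n^{(p)}\times B_n^{(p)})$; the associative spectrum is $s_n(\mathbf{A})=|B_n^{(p)}/\sigma_n(\mathbf{A})|$. $FS$ is the set of all fine spectra of $p$-ary groupoids; ordered by inclusion it is a complete lattice $\mathbf{FS}$.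 An atom is an element covering the least element; a coatom is an element covered by the greatest element. *)

theory Defs
  imports "HOL-Algebra.Complete_Lattice" "HOL-Library.Countable_Set"
begin

section \<open>Terms and bracketings\<close>

datatype 'v pterm = Var 'v | Omega "'v pterm list"

instance pterm :: (countable) countable
  by countable_datatype

fun p_ary :: "nat \<Rightarrow> 'v pterm \<Rightarrow> bool" where
  "p_ary p (Var v) = True"
| "p_ary p (Omega ts) = (length ts = p \<and> (\<forall>t \<in> set ts. p_ary p t))"

primrec omegas :: "'v pterm \<Rightarrow> nat" where
  "omegas (Var v) = 0"
| "omegas (Omega ts) = Suc (sum_list (map omegas ts))"

primrec leaves :: "'v pterm \<Rightarrow> nat" where
  "leaves (Var v) = 1"
| "leaves (Omega ts) = sum_list (map leaves ts)"

text \<open>Bracketings are terms over a single variable, hence over the one-element type \<^typ>\<open>unit\<close>;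
  the variable \<open>x\<close> is \<^term>\<open>Var ()\<close>.\<close>

type_synonym bracketing = "unit pterm"

definition bracketings :: "nat \<Rightarrow> bracketing set" where
  "bracketings p = {t. p_ary p t}"

definition bracketings_n :: "nat \<Rightarrow> nat \<Rightarrow> bracketing set" where
  "bracketings_n p n = {t \<in> bracketings p. omegas t = n}"

definition Lam :: "nat \<Rightarrow> (bracketing \<times> bracketing) set" where
  "Lam p = {(s, t). s \<in> bracketings p \<and> t \<in> bracketings p \<and> omegas s = omegas t}"

text \<open>\<open>label k t\<close> replaces the leaves of \<open>t\<close>, from left to right, by the variables
  \<open>k, k + 1, k + 2, \<dots>\<close>; the variable \<open>x\<^sub>i\<close> is \<open>Var i\<close>.\<close>

fun label :: "nat \<Rightarrow> bracketing \<Rightarrow> nat pterm"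
  and labels :: "nat \<Rightarrow> bracketing list \<Rightarrow> nat pterm list" where
  "label k (Var u) = Var k"
| "label k (Omega ts) = Omega (labels k ts)"
| "labels k [] = []"
| "labels k (t # ts) = label k t # labels (k + leaves t) ts"

definition eps1 :: "bracketing \<Rightarrow> nat pterm" where
  "eps1 t = label 1 t"


section \<open>Groupoids and their spectra\<close>

text \<open>Only the values of \<open>oper\<close> on lists of length \<open>p\<close> over the carrier matter.\<close>

record 'a groupoid = "'a partial_object" +
  oper :: "'a list \<Rightarrow> 'a"

definition p_groupoid :: "nat \<Rightarrow> 'a groupoid \<Rightarrow> bool" where
  "p_groupoid p A \<longleftrightarrow> carrier A \<noteq> {} \<and>
     (\<forall>as. length as = p \<and> set as \<subseteq> carrier A \<longrightarrow> oper A as \<in> carrier A)"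

primrec evalt :: "'a groupoid \<Rightarrow> ('v \<Rightarrow> 'a) \<Rightarrow> 'v pterm \<Rightarrow> 'a" where
  "evalt A h (Var v) = h v"
| "evalt A h (Omega ts) = oper A (map (evalt A h) ts)"

definition satisfies :: "'a groupoid \<Rightarrow> nat pterm \<Rightarrow> nat pterm \<Rightarrow> bool" where
  "satisfies A s t \<longleftrightarrow> (\<forall>h. range h \<subseteq> carrier A \<longrightarrow> evalt A h s = evalt A h t)"

definition fine_spectrum :: "nat \<Rightarrow> 'a groupoid \<Rightarrow> (bracketing \<times> bracketing) set" where
  "fine_spectrum p A = {(s, t) \<in> Lam p. satisfies A (eps1 s) (eps1 t)}"

definition fine_spectrum_n ::
    "nat \<Rightarrow> 'a groupoid \<Rightarrow> nat \<Rightarrow> (bracketing \<times> bracketing) set" where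
  "fine_spectrum_n p A n = fine_spectrum p A \<inter> (bracketings_n p n \<times> bracketings_n p n)"

definition assoc_spectrum :: "nat \<Rightarrow> 'a groupoid \<Rightarrow> nat \<Rightarrow> nat" where
  "assoc_spectrum p A n = card (bracketings_n p n // fine_spectrum_n p A n)"

text \<open>HOL cannot quantify over the carrier types of all groupoids in one set, so \<open>FS\<close> collects
  the fine spectra of groupoids whose carrier is a subset of \<open>nat\<close>. This loses nothing: a groupoid
  of arbitrary cardinality has a countable subgroupoid with the same fine spectrum,
  see \<open>fine_spectrum_in_FS\<close> below.\<close>

definition FS :: "nat \<Rightarrow> (bracketing \<times> bracketing) set set" where
  "FS p = {fine_spectrum p A | A :: nat groupoid. p_groupoid p A}"

definition FS_order :: "nat \<Rightarrow> (bracketing \<times> bracketing) set gorder" where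
  "FS_order p = \<lparr>carrier = FS p, eq = (=), le = (\<subseteq>)\<rparr>"


section \<open>Atoms and coatoms\<close>

definition covers :: "('a, 'b) gorder_scheme \<Rightarrow> 'a \<Rightarrow> 'a \<Rightarrow> bool" where
  "covers L a b \<longleftrightarrow> a \<in> carrier L \<and> b \<in> carrier L \<and> b \<sqsubset>\<^bsub>L\<^esub> a \<and>
     \<not> (\<exists>c \<in> carrier L. b \<sqsubset>\<^bsub>L\<^esub> c \<and> c \<sqsubset>\<^bsub>L\<^esub> a)"

definition atom :: "('a, 'b) gorder_scheme \<Rightarrow> 'a \<Rightarrow> bool" where
  "atom L a \<longleftrightarrow> covers L a \<bottom>\<^bsub>L\<^esub>"

definition coatom :: "('a, 'b) gorder_scheme \<Rightarrow> 'a \<Rightarrow> bool" where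
  "coatom L a \<longleftrightarrow> covers L \<top>\<^bsub>L\<^esub> a"


section \<open>\<open>FS\<close> contains all fine spectra and is a complete lattice\<close>

lemma p_ary_label:
  shows "p_ary p t \<Longrightarrow> p_ary p (label k t)"
    and "(\<forall>t \<in> set ts. p_ary p t) \<Longrightarrow>
      length (labels k ts) = length ts \<and> (\<forall>t \<in> set (labels k ts). p_ary p t)"
  by (induction k t and k ts rule: label_labels.induct) auto

lemma p_ary_eps1: "t \<in> bracketings p \<Longrightarrow> p_ary p (eps1 t)"
  by (simp add: bracketings_def eps1_def p_ary_label)

lemma evalt_closed:
  assumes "p_groupoid p A" "range h \<subseteq> carrier A"
  shows "p_ary p t \<Longrightarrow> evalt A h t \<in> carrier A"
proof (induction t)
  case (Var v)
  then show ?case using assms by auto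
next
  case (Omega ts)
  then have "length (map (evalt A h) ts) = p" "set (map (evalt A h) ts) \<subseteq> carrier A"
    by auto
  then show ?case using assms(1) unfolding p_groupoid_def by simp
qed

lemma evalt_iso:
  assumes inj: "inj_on e C" and C: "p_groupoid p A'" "carrier A' = C"
    and op: "\<And>as. length as = p \<Longrightarrow> set as \<subseteq> C \<Longrightarrow> oper A' as = oper A as"
    and opD: "oper D = (\<lambda>xs. e (oper A (map (inv_into C e) xs)))"
    and h: "range h \<subseteq> e ` C"
  shows "p_ary p t \<Longrightarrow> evalt D h t = e (evalt A (inv_into C e \<circ> h) t) \<and>
    evalt A (inv_into C e \<circ> h) t \<in> C"
proof (induction t)
  case (Var v)
  have "h v \<in> e ` C" using h by auto
  then show ?case by (simp add: f_inv_into_f inv_into_into)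
next
  case (Omega ts)
  let ?g = "evalt A (inv_into C e \<circ> h)"
  have *: "\<And>t. t \<in> set ts \<Longrightarrow> evalt D h t = e (?g t) \<and> ?g t \<in> C"
    using Omega.IH Omega.prems unfolding p_ary.simps by blast
  have "map (inv_into C e) (map (evalt D h) ts) = map ?g ts"
    using * inj by (auto simp: inv_into_f_f)
  moreover have "length (map ?g ts) = p" "set (map ?g ts) \<subseteq> C"
    using * Omega.prems by auto
  then have "oper A (map ?g ts) \<in> C"
    using C op unfolding p_groupoid_def by metis
  ultimately show ?case unfolding evalt.simps opD by metis
qed

lemma fine_spectrum_in_FS:
  fixes A :: "'a groupoid"
  assumes A: "p_groupoid p A"
  shows "fine_spectrum p A \<in> FS p"
proof -
  define N where "N = Lam p - fine_spectrum p A"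
  have "\<forall>st \<in> N. \<exists>h. range h \<subseteq> carrier A \<and>
      evalt A h (eps1 (fst st)) \<noteq> evalt A h (eps1 (snd st))"
    by (auto simp: N_def fine_spectrum_def satisfies_def)
  then obtain H where H: "\<And>st. st \<in> N \<Longrightarrow> range (H st) \<subseteq> carrier A \<and>
      evalt A (H st) (eps1 (fst st)) \<noteq> evalt A (H st) (eps1 (snd st))"
    by metis
  obtain c where c: "c \<in> carrier A" using A by (auto simp: p_groupoid_def)
  define S where "S = insert c (\<Union>st \<in> N. range (H st))"
  have S: "countable S" "S \<noteq> {}" "S \<subseteq> carrier A"
    using H c by (auto simp: S_def)
  define g where "g = from_nat_into S"
  have g: "range g = S" unfolding g_def using S by (simp add: range_from_nat_into)
  define C where "C = evalt A g ` {u. p_ary p u}"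
  have cC: "countable C" by (simp add: C_def)
  have CA: "C \<subseteq> carrier A"
    using evalt_closed[OF A] g S by (auto simp: C_def)
  have SC: "S \<subseteq> C"
  proof
    fix a assume "a \<in> S"
    then obtain n where "a = g n" using g by auto
    then show "a \<in> C" unfolding C_def by (intro image_eqI[of _ _ "Var n"]) auto
  qed
  have closed: "oper A as \<in> C" if "length as = p" "set as \<subseteq> C" for as
  proof -
    have "\<forall>a \<in> set as. \<exists>u. p_ary p u \<and> evalt A g u = a"
      using that by (auto simp: C_def)
    then obtain U where U: "\<And>a. a \<in> set as \<Longrightarrow> p_ary p (U a) \<and> evalt A g (U a) = a"
      by metis
    have "p_ary p (Omega (map U as))" using U that by auto
    moreover have "map (evalt A g \<circ> U) as = as"
      using U by (auto intro: map_idI)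
    then have "evalt A g (Omega (map U as)) = oper A as" by simp
    ultimately show ?thesis unfolding C_def by (metis (mono_tags) image_eqI mem_Collect_eq)
  qed
  define e where "e = to_nat_on C"
  have e: "inj_on e C" unfolding e_def using cC by (rule inj_on_to_nat_on)
  define A' where "A' = \<lparr>carrier = C, oper = oper A\<rparr>"
  have A': "p_groupoid p A'" "carrier A' = C"
    using closed SC S by (auto simp: A'_def p_groupoid_def)
  define D where "D = \<lparr>carrier = e ` C, oper = (\<lambda>xs. e (oper A (map (inv_into C e) xs)))\<rparr>"
  have D: "p_groupoid p D"
  proof -
    have "oper A (map (inv_into C e) xs) \<in> C" if "length xs = p" "set xs \<subseteq> e ` C" for xs
      using that by (intro closed) (auto intro: inv_into_into)
    then show ?thesis using SC S by (auto simp: D_def p_groupoid_def)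
  qed
  have ev: "evalt D h t = e (evalt A (inv_into C e \<circ> h) t) \<and>
      evalt A (inv_into C e \<circ> h) t \<in> C" if "range h \<subseteq> e ` C" "p_ary p t" for h :: "nat \<Rightarrow> nat" and t
    by (rule evalt_iso[OF e A' _ _ that]) (auto simp: A'_def D_def)
  have "satisfies D (eps1 s) (eps1 t) \<longleftrightarrow> satisfies A (eps1 s) (eps1 t)" if st: "(s, t) \<in> Lam p" for s t
  proof -
    have pst: "p_ary p (eps1 s)" "p_ary p (eps1 t)"
      using st by (auto simp: Lam_def p_ary_eps1)
    show ?thesis
    proof
      assume sat: "satisfies A (eps1 s) (eps1 t)"
      show "satisfies D (eps1 s) (eps1 t)" unfolding satisfies_def
      proof (intro allI impI)
        fix h :: "nat \<Rightarrow> nat" assume h: "range h \<subseteq> carrier D"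
        then have h': "range h \<subseteq> e ` C" by (simp add: D_def)
        have "range (inv_into C e \<circ> h) \<subseteq> carrier A"
          using h' CA inv_into_into[of _ e C] by fastforce
        then show "evalt D h (eps1 s) = evalt D h (eps1 t)"
          using sat ev[OF h'] pst unfolding satisfies_def by metis
      qed
    next
      assume sat: "satisfies D (eps1 s) (eps1 t)"
      show "satisfies A (eps1 s) (eps1 t)"
      proof (rule ccontr)
        assume "\<not> satisfies A (eps1 s) (eps1 t)"
        then have N: "(s, t) \<in> N" using st by (auto simp: N_def fine_spectrum_def)
        let ?k = "H (s, t)"
        have k: "range ?k \<subseteq> C" using N SC by (auto simp: S_def)
        define h where "h = e \<circ> ?k"
        have h': "range h \<subseteq> e ` C" using k by (auto simp: h_def)
        have "inv_into C e \<circ> h = ?k"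
          using k e by (auto simp: h_def fun_eq_iff inv_into_f_f image_subset_iff)
        moreover have "evalt D h (eps1 s) = evalt D h (eps1 t)"
          using sat h' by (simp add: satisfies_def D_def)
        ultimately have "evalt A ?k (eps1 s) = evalt A ?k (eps1 t)"
          using ev[OF h'] pst e by (metis inj_onD)
        then show False using H[OF N] by simp
      qed
    qed
  qed
  then have "fine_spectrum p D = fine_spectrum p A"
    by (auto simp: fine_spectrum_def)
  then show ?thesis using D unfolding FS_def by blast
qed

lemma Lam_in_FS: "Lam p \<in> FS p"
proof -
  let ?A = "\<lparr>carrier = {()}, oper = (\<lambda>_. ())\<rparr>"
  have "p_groupoid p ?A" by (simp add: p_groupoid_def)
  then have "fine_spectrum p ?A \<in> FS p" by (rule fine_spectrum_in_FS)
  moreover have "fine_spectrum p ?A = Lam p"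
    by (simp add: fine_spectrum_def satisfies_def)
  ultimately show ?thesis by simp
qed

lemma FS_subset_Lam: "\<theta> \<in> FS p \<Longrightarrow> \<theta> \<subseteq> Lam p"
  by (auto simp: FS_def fine_spectrum_def)

lemma Inter_in_FS:
  assumes F: "F \<subseteq> FS p" "F \<noteq> {}"
  shows "\<Inter>F \<in> FS p"
proof -
  have "\<forall>\<theta> \<in> F. \<exists>A :: nat groupoid. p_groupoid p A \<and> fine_spectrum p A = \<theta>"
    using F by (auto simp: FS_def)
  then obtain G :: "_ \<Rightarrow> nat groupoid"
    where G: "\<And>\<theta>. \<theta> \<in> F \<Longrightarrow> p_groupoid p (G \<theta>) \<and> fine_spectrum p (G \<theta>) = \<theta>"
    by metis
  define P where "P = \<lparr>carrier = {f. \<forall>\<theta>. if \<theta> \<in> F then f \<theta> \<in> carrier (G \<theta>) else f \<theta> = 0},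
    oper = (\<lambda>fs \<theta>. if \<theta> \<in> F then oper (G \<theta>) (map (\<lambda>f. f \<theta>) fs) else 0)\<rparr>"
  have "\<forall>\<theta>. \<exists>a. if \<theta> \<in> F then a \<in> carrier (G \<theta>) else a = 0"
    using G unfolding p_groupoid_def by (metis ex_in_conv)
  then obtain d where d: "\<And>\<theta>. if \<theta> \<in> F then d \<theta> \<in> carrier (G \<theta>) else d \<theta> = 0"
    by metis
  have dP: "d \<in> carrier P" using d by (simp add: P_def)
  have cl: "oper P fs \<in> carrier P" if "length fs = p" "set fs \<subseteq> carrier P" for fs
  proof -
    have "oper (G \<theta>) (map (\<lambda>f. f \<theta>) fs) \<in> carrier (G \<theta>)" if \<theta>: "\<theta> \<in> F" for \<theta>
    proof -
      have "set (map (\<lambda>f. f \<theta>) fs) \<subseteq> carrier (G \<theta>)"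
        using \<open>set fs \<subseteq> carrier P\<close> \<theta> by (force simp: P_def)
      then show ?thesis using G[OF \<theta>] \<open>length fs = p\<close> by (simp add: p_groupoid_def)
    qed
    then show ?thesis by (simp add: P_def)
  qed
  have P: "p_groupoid p P" using dP cl by (auto simp: p_groupoid_def)
  have ev: "evalt P h t \<theta> = evalt (G \<theta>) (\<lambda>v. h v \<theta>) t" if "\<theta> \<in> F" for h \<theta> and t :: "nat pterm"
  proof (induction t)
    case (Omega ts)
    have "map (\<lambda>f. f \<theta>) (map (evalt P h) ts) = map (evalt (G \<theta>) (\<lambda>v. h v \<theta>)) ts"
      using Omega by simp
    moreover have "oper P fs \<theta> = oper (G \<theta>) (map (\<lambda>f. f \<theta>) fs)" for fs
      using that by (simp add: P_def)
    ultimately show ?case unfolding evalt.simps by metis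
  qed simp
  have "satisfies P (eps1 s) (eps1 t) \<longleftrightarrow> (\<forall>\<theta> \<in> F. satisfies (G \<theta>) (eps1 s) (eps1 t))"
    if st: "(s, t) \<in> Lam p" for s t
  proof
    assume sat: "satisfies P (eps1 s) (eps1 t)"
    show "\<forall>\<theta> \<in> F. satisfies (G \<theta>) (eps1 s) (eps1 t)"
      unfolding satisfies_def
    proof (intro ballI allI impI)
      fix \<theta> and h :: "nat \<Rightarrow> nat" assume \<theta>: "\<theta> \<in> F" and h: "range h \<subseteq> carrier (G \<theta>)"
      define k where "k v = d(\<theta> := h v)" for v :: nat
      have "range k \<subseteq> carrier P"
        using d h \<theta> by (auto simp: k_def P_def image_subset_iff)
      then have "evalt P k (eps1 s) \<theta> = evalt P k (eps1 t) \<theta>"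
        using sat by (simp add: satisfies_def)
      then show "evalt (G \<theta>) h (eps1 s) = evalt (G \<theta>) h (eps1 t)"
        using ev[OF \<theta>, of k] by (simp add: k_def)
    qed
  next
    assume sat: "\<forall>\<theta> \<in> F. satisfies (G \<theta>) (eps1 s) (eps1 t)"
    have pst: "p_ary p (eps1 s)" "p_ary p (eps1 t)"
      using st by (auto simp: Lam_def p_ary_eps1)
    show "satisfies P (eps1 s) (eps1 t)" unfolding satisfies_def
    proof (intro allI impI ext)
      fix \<theta> and h :: "nat \<Rightarrow> _" assume h: "range h \<subseteq> carrier P"
      have hP: "evalt P h (eps1 s) \<in> carrier P" "evalt P h (eps1 t) \<in> carrier P"
        using evalt_closed[OF P h] pst by auto
      show "evalt P h (eps1 s) \<theta> = evalt P h (eps1 t) \<theta>"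
      proof (cases "\<theta> \<in> F")
        case True
        have "h v \<theta> \<in> carrier (G \<theta>)" for v
          using h True by (force simp: P_def image_subset_iff)
        then have "range (\<lambda>v. h v \<theta>) \<subseteq> carrier (G \<theta>)" by auto
        then show ?thesis using sat True by (simp add: ev satisfies_def)
      next
        case False
        then show ?thesis using hP by (simp add: P_def)
      qed
    qed
  qed
  moreover have "\<theta> = {(s, t) \<in> Lam p. satisfies (G \<theta>) (eps1 s) (eps1 t)}" if "\<theta> \<in> F" for \<theta>
    using G[OF that] by (simp add: fine_spectrum_def)
  then have "(s, t) \<in> \<theta> \<longleftrightarrow> (s, t) \<in> Lam p \<and> satisfies (G \<theta>) (eps1 s) (eps1 t)"
    if "\<theta> \<in> F" for \<theta> s t using that by blast
  ultimately have "(s, t) \<in> fine_spectrum p P \<longleftrightarrow> (s, t) \<in> \<Inter>F" for s t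
    using F(2) by (auto simp: fine_spectrum_def)
  then have "fine_spectrum p P = \<Inter>F" by auto
  then show ?thesis using fine_spectrum_in_FS[OF P] by simp
qed

lemma FS_complete_lattice: "complete_lattice (FS_order p)"
proof -
  interpret partial_order "FS_order p"
    by unfold_locales (auto simp: FS_order_def)
  show ?thesis
  proof (rule complete_lattice_criterion1)
    show "\<exists>g. greatest (FS_order p) g (carrier (FS_order p))"
      using Lam_in_FS FS_subset_Lam
      by (intro exI[of _ "Lam p"]) (auto simp: greatest_def FS_order_def)
  next
    fix F assume "F \<subseteq> carrier (FS_order p)" "F \<noteq> {}"
    then show "\<exists>i. greatest (FS_order p) i (Lower (FS_order p) F)"
      using Inter_in_FS[of F p]
      by (intro exI[of _ "\<Inter>F"]) (auto simp: greatest_def Lower_def FS_order_def)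
  qed
qed

end

theory Submission
  imports Defs
begin

text \<open>Fine spectra are exactly the congruences \<open>\<theta> \<subseteq> \<Lambda>\<close> of the algebra of bracketings that are
  closed under substituting bracketings for the leaves. Applying \<open>\<omega>\<close> and substituting never
  decrease the number of \<open>\<omega>\<close>'s. Hence discarding the
  non-trivial pairs of \<open>\<theta>\<close> at the levels up to \<open>n\<close>, or adding all pairs above level \<open>n\<close>, gives a fine
  spectrum again. The first operation properly shrinks every non-trivial \<open>\<theta>\<close> to a non-trivial one, so
  there are no atoms. The second shows that a coatom is full above every level where it is not full;
  it is not full at level 2, since that would be general associativity and force \<open>\<theta> = \<Lambda>\<close>. So it
  differs from \<open>\<Lambda>\<close> at level 2 only, where every equivalence relation is allowed.\<close>

section \<open>Substitution\<close>

text \<open>The variable type may change: \<open>bind h (eps1 t)\<close> first makes the leaves of a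
  bracketing distinct and then replaces each by a bracketing of its own, which gives a bracketing
  again.\<close>

primrec bind :: "('v \<Rightarrow> 'w pterm) \<Rightarrow> 'v pterm \<Rightarrow> 'w pterm" where
  "bind h (Var v) = h v"
| "bind h (Omega ts) = Omega (map (bind h) ts)"

primrec leaf_vars :: "'v pterm \<Rightarrow> 'v list" where
  "leaf_vars (Var v) = [v]"
| "leaf_vars (Omega ts) = concat (map leaf_vars ts)"

abbreviation shape :: "'v pterm \<Rightarrow> bracketing" where
  "shape \<equiv> map_pterm (\<lambda>_. ())"

section \<open>Arity, operation symbols and leaves\<close>

lemma bracketings_iff [simp]: "t \<in> bracketings p \<longleftrightarrow> p_ary p t"
  by (simp add: bracketings_def)

lemma Lam_iff [simp]: "(s, t) \<in> Lam p \<longleftrightarrow> p_ary p s \<and> p_ary p t \<and> omegas s = omegas t"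
  by (simp add: Lam_def)

lemma p_ary_map_pterm [simp]: "p_ary p (map_pterm f t) = p_ary p t"
  by (induction t) auto

lemma omegas_map_pterm [simp]: "omegas (map_pterm f t) = omegas t"
  by (induction t) (auto simp: comp_def cong: map_cong)

lemma p_ary_bind: "p_ary p t \<Longrightarrow> (\<And>v. p_ary p (h v)) \<Longrightarrow> p_ary p (bind h t)"
  by (induction t) auto

text \<open>Every \<open>Omega\<close> node joins p subterms into one, so a p-ary term with n of
  them has (p - 1)n + 1 leaves. The additive form avoids subtraction on naturals.\<close>

lemma leaves_omegas: "p_ary p t \<Longrightarrow> leaves t + omegas t = p * omegas t + 1"
proof (induction t)
  case (Omega ts)
  \<comment> \<open>The children are summed by an inner induction over an arbitrary list
    \<open>us\<close> of children, for whose members the outer hypothesis remains available.\<close>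
  have "sum_list (map leaves us) + sum_list (map omegas us)
      = p * sum_list (map omegas us) + length us" if "set us \<subseteq> set ts" for us
    using that
  proof (induction us)
    case (Cons u us)
    then show ?case using Omega by (force simp: algebra_simps)
  qed simp
  from this[of ts] show ?case using Omega.prems by simp
qed simp

lemma Lam_leaves: "(s, t) \<in> Lam p \<Longrightarrow> leaves s = leaves t"
  using leaves_omegas[of p s] leaves_omegas[of p t] by simp

lemma leaf_vars_label:
  "leaf_vars (label k t) = [k..<k + leaves t]"
  "concat (map leaf_vars (labels k ts)) = [k..<k + sum_list (map leaves ts)]"
proof (induction k t and k ts rule: label_labels.induct)
  case (4 k t ts)
  then show ?case
    by (simp add: upt_add_eq_append[symmetric] add.assoc[symmetric])
qed auto

lemma labels_append: "labels k (xs @ ys) = labels k xs @ labels (k + sum_list (map leaves xs)) ys"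
  by (induction xs arbitrary: k) (auto simp: add.assoc)

lemma labels_replicate: "labels k (replicate n (Var ())) = map Var [k..<k + n]"
  by (induction n arbitrary: k) (auto simp: upt_conv_Cons)

text \<open>Equal leaf counts make both words x_1, ..., x_m with the same m. Hence a substitution
  inserts the same terms in the same order on both sides.\<close>

lemma leaf_vars_eps1: "(s, t) \<in> Lam p \<Longrightarrow> leaf_vars (eps1 s) = leaf_vars (eps1 t)"
  using Lam_leaves[of s t p] by (simp add: eps1_def leaf_vars_label)

lemma shape_label:
  "shape (label k t) = t"
  "map shape (labels k ts) = ts"
  by (induction k t and k ts rule: label_labels.induct) auto

lemma shape_eps1 [simp]: "shape (eps1 t) = t"
  by (simp add: eps1_def shape_label)

lemma omegas_eps1 [simp]: "omegas (eps1 t) = omegas t"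
  by (metis omegas_map_pterm shape_eps1)

lemma p_ary_eps1_iff [simp]: "p_ary p (eps1 t) = p_ary p t"
  by (metis p_ary_map_pterm shape_eps1)

section \<open>Effect of substitution on shape, leaf word, level and value\<close>

lemma shape_bind: "shape (bind h t) = bind (shape \<circ> h) t"
  by (induction t) auto

lemma bind_Var: "bind Var t = t"
  by (induction t) (auto intro: map_idI)

lemma leaf_vars_bind: "leaf_vars (bind h t) = concat (map (leaf_vars \<circ> h) (leaf_vars t))"
proof (induction t)
  case (Omega ts)
  have "concat (map (leaf_vars \<circ> bind h) us)
      = concat (map (leaf_vars \<circ> h) (concat (map leaf_vars us)))" if "set us \<subseteq> set ts" for us
    using that
  proof (induction us)
    case (Cons u us)
    then show ?case using Omega by force
  qed simp
  from this[of ts] show ?case by (simp add: comp_def)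
qed simp

lemma omegas_bind: "omegas (bind h t) = omegas t + sum_list (map (omegas \<circ> h) (leaf_vars t))"
proof (induction t)
  case (Omega ts)
  have "sum_list (map (omegas \<circ> bind h) us) = sum_list (map omegas us)
      + sum_list (map (omegas \<circ> h) (concat (map leaf_vars us)))" if "set us \<subseteq> set ts" for us
    using that
  proof (induction us)
    case (Cons u us)
    then show ?case using Omega by force
  qed simp
  from this[of ts] show ?case by (simp add: comp_def)
qed simp

lemma Lam_bind:
  assumes "(s, t) \<in> Lam p" and "\<And>i. p_ary p (h i)"
  shows "(bind h (eps1 s), bind h (eps1 t)) \<in> Lam p"
  using assms leaf_vars_eps1[OF assms(1)] by (simp add: p_ary_bind omegas_bind)

lemma Lam_Omega:
  assumes "length ss = p" "list_all2 (\<lambda>s t. (s, t) \<in> Lam p) ss ts"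
  shows "(Omega ss, Omega ts) \<in> Lam p"
proof -
  have "(\<forall>s \<in> set ss. p_ary p s) \<and> (\<forall>t \<in> set ts. p_ary p t) \<and>
      sum_list (map omegas ss) = sum_list (map omegas ts)"
    using assms(2) by (induction rule: list_all2_induct) auto
  then show ?thesis using assms(1) list_all2_lengthD[OF assms(2)] by simp
qed

lemma bind_no_omegas:
  fixes h :: "'v \<Rightarrow> bracketing"
  assumes "\<And>v. v \<in> set (leaf_vars t) \<Longrightarrow> omegas (h v) = 0"
  shows "bind h t = shape t"
  using assms
proof (induction t)
  case (Var v)
  then show ?case by (cases "h v") auto
qed auto

lemma evalt_bind: "evalt A g (bind h t) = evalt A (\<lambda>v. evalt A g (h v)) t"
proof (induction t)
  case (Omega ts)
  then have "map (evalt A g \<circ> bind h) ts = map (evalt A (\<lambda>v. evalt A g (h v))) ts" by simp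
  then show ?case by (simp only: bind.simps evalt.simps list.map_comp)
qed simp

text \<open>Relabelling after a substitution is itself a substitution: \<open>f i\<close> is the
  first label of the block of leaves contributed by \<open>h i\<close>, and the assumption says that
  these blocks are consecutive. The second conjuncts carry the label counter through the mutual
  induction.\<close>

lemma label_bind:
  assumes f: "\<And>i. i \<ge> 1 \<Longrightarrow> f (Suc i) = f i + leaves (h i)"
  shows "m \<ge> 1 \<Longrightarrow> label (f m) (bind h (label m s)) = bind (\<lambda>i. label (f i) (h i)) (label m s) \<and>
      f m + leaves (bind h (label m s)) = f (m + leaves s)"
    and "m \<ge> 1 \<Longrightarrow> labels (f m) (map (bind h) (labels m ss))
        = map (bind (\<lambda>i. label (f i) (h i))) (labels m ss) \<and>
      f m + sum_list (map (leaves \<circ> bind h) (labels m ss)) = f (m + sum_list (map leaves ss))"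
proof (induction m s and m ss rule: label_labels.induct)
  case (4 k t ts)
  then show ?case by (simp add: add.assoc[symmetric])
qed (auto simp: f)

lemma label_shift:
  "label (k + j) t = map_pterm (\<lambda>i. i + j) (label k t)"
  "labels (k + j) ts = map (map_pterm (\<lambda>i. i + j)) (labels k ts)"
proof (induction k t and k ts rule: label_labels.induct)
  case (4 k t ts)
  then show ?case by (simp add: add.commute add.left_commute)
qed auto

lemma evalt_map_pterm: "evalt A h (map_pterm f t) = evalt A (h \<circ> f) t"
proof (induction t)
  case (Omega ts)
  then have "map (evalt A h \<circ> map_pterm f) ts = map (evalt A (h \<circ> f)) ts" by (simp add: comp_def)
  then show ?case by (simp only: pterm.map evalt.simps list.map_comp)
qed simp


section \<open>Fine spectra as invariant congruences\<close>

text \<open>The intrinsic description of the elements of \<open>FS\<close>, see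
  \<open>FS_iff\<close>. Through \<open>eps1\<close> the last clause may substitute differently at
  each leaf position.\<close>

definition fine_congruence :: "nat \<Rightarrow> (bracketing \<times> bracketing) set \<Rightarrow> bool" where
  "fine_congruence p \<theta> \<longleftrightarrow> equiv (bracketings p) \<theta> \<and> \<theta> \<subseteq> Lam p \<and>
    (\<forall>ss ts. length ss = p \<and> list_all2 (\<lambda>s t. (s, t) \<in> \<theta>) ss ts \<longrightarrow> (Omega ss, Omega ts) \<in> \<theta>) \<and>
    (\<forall>s t h. (s, t) \<in> \<theta> \<and> (\<forall>i. p_ary p (h i)) \<longrightarrow> (bind h (eps1 s), bind h (eps1 t)) \<in> \<theta>)"

lemma fine_congruenceI:
  assumes "\<theta> \<subseteq> Lam p"
    and "\<And>s. p_ary p s \<Longrightarrow> (s, s) \<in> \<theta>"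
    and "\<And>s t. (s, t) \<in> \<theta> \<Longrightarrow> (t, s) \<in> \<theta>"
    and "\<And>s t u. (s, t) \<in> \<theta> \<Longrightarrow> (t, u) \<in> \<theta> \<Longrightarrow> (s, u) \<in> \<theta>"
    and "\<And>ss ts. length ss = p \<Longrightarrow> list_all2 (\<lambda>s t. (s, t) \<in> \<theta>) ss ts \<Longrightarrow> (Omega ss, Omega ts) \<in> \<theta>"
    and "\<And>s t h. (s, t) \<in> \<theta> \<Longrightarrow> (\<And>i. p_ary p (h i)) \<Longrightarrow> (bind h (eps1 s), bind h (eps1 t)) \<in> \<theta>"
  shows "fine_congruence p \<theta>"
proof -
  have "\<theta> \<subseteq> bracketings p \<times> bracketings p" using assms(1) by auto
  moreover have "refl_on (bracketings p) \<theta>" using assms(2) by (simp add: refl_on_def)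
  moreover have "sym \<theta>" "trans \<theta>" using assms(3,4) by (blast intro: symI transI)+
  ultimately have "equiv (bracketings p) \<theta>" by (simp add: equiv_def)
  then show ?thesis using assms(1,5,6) by (simp add: fine_congruence_def)
qed

lemma
  assumes "fine_congruence p \<theta>"
  shows fine_congruence_Lam: "\<theta> \<subseteq> Lam p"
    and fine_congruence_equiv: "equiv (bracketings p) \<theta>"
    and fine_congruence_refl: "p_ary p s \<Longrightarrow> (s, s) \<in> \<theta>"
    and fine_congruence_sym: "(s, t) \<in> \<theta> \<Longrightarrow> (t, s) \<in> \<theta>"
    and fine_congruence_trans: "(s, t) \<in> \<theta> \<Longrightarrow> (t, u) \<in> \<theta> \<Longrightarrow> (s, u) \<in> \<theta>"
    and fine_congruence_Omega:
      "length ss = p \<Longrightarrow> list_all2 (\<lambda>s t. (s, t) \<in> \<theta>) ss ts \<Longrightarrow> (Omega ss, Omega ts) \<in> \<theta>"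
    and fine_congruence_bind:
      "(s, t) \<in> \<theta> \<Longrightarrow> (\<And>i. p_ary p (h i)) \<Longrightarrow> (bind h (eps1 s), bind h (eps1 t)) \<in> \<theta>"
proof -
  show L: "\<theta> \<subseteq> Lam p" and E: "equiv (bracketings p) \<theta>"
    using assms by (auto simp: fine_congruence_def)
  show "p_ary p s \<Longrightarrow> (s, s) \<in> \<theta>"
    using E by (simp add: equiv_def refl_on_def)
  show "(s, t) \<in> \<theta> \<Longrightarrow> (t, s) \<in> \<theta>"
    using E by (meson equivE symD)
  show "(s, t) \<in> \<theta> \<Longrightarrow> (t, u) \<in> \<theta> \<Longrightarrow> (s, u) \<in> \<theta>"
    using E by (meson equivE transD)
  show "length ss = p \<Longrightarrow> list_all2 (\<lambda>s t. (s, t) \<in> \<theta>) ss ts \<Longrightarrow> (Omega ss, Omega ts) \<in> \<theta>"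
    and "(s, t) \<in> \<theta> \<Longrightarrow> (\<And>i. p_ary p (h i)) \<Longrightarrow> (bind h (eps1 s), bind h (eps1 t)) \<in> \<theta>"
    using assms by (simp_all add: fine_congruence_def)
qed

text \<open>Related terms have equally many leaves, so in a compound term related arguments receive
  the same block of labels, and the identity applies after a shift. Closure under substitution holds
  because the new identity is an instance of the old one.\<close>

lemma fine_congruence_fine_spectrum:
  assumes A: "p_groupoid p A"
  shows "fine_congruence p (fine_spectrum p A)"
proof (rule fine_congruenceI)
  fix ss ts assume len: "length ss = p" and rel: "list_all2 (\<lambda>s t. (s, t) \<in> fine_spectrum p A) ss ts"
  \<comment> \<open>The start \<open>k\<close> is general because the labels of a child begin where
    those of its predecessors end.\<close>
  have "map (evalt A h) (labels k ss) = map (evalt A h) (labels k ts) \<and>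
      sum_list (map omegas ss) = sum_list (map omegas ts) \<and>
      (\<forall>s \<in> set ss. p_ary p s) \<and> (\<forall>t \<in> set ts. p_ary p t)"
    if h: "range h \<subseteq> carrier A" and "k \<ge> 1" for h k
    using rel \<open>k \<ge> 1\<close>
  proof (induction arbitrary: k rule: list_all2_induct)
    case (Cons s ss t ts)
    then have st: "(s, t) \<in> Lam p" "satisfies A (label 1 s) (label 1 t)"
      by (auto simp: fine_spectrum_def eps1_def)
    obtain j where k: "k = 1 + j" using Cons.prems le_Suc_ex by blast
    have "range (h \<circ> (\<lambda>i. i + j)) \<subseteq> carrier A" using h by auto
    then have "evalt A h (label k s) = evalt A h (label k t)"
      using st(2) unfolding k label_shift evalt_map_pterm satisfies_def by blast
    then show ?case using Cons.IH[of "k + leaves t"] Cons.prems Lam_leaves[OF st(1)] st(1) by simp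
  qed simp
  note * = this
  \<comment> \<open>The facts about arity and level do not mention the assignment, but reading them
    off \<open>*\<close> takes one; a constant assignment serves.\<close>
  obtain c where "c \<in> carrier A" using A by (auto simp: p_groupoid_def)
  then have "range (\<lambda>_ :: nat. c) \<subseteq> carrier A" by auto
  then have "(Omega ss, Omega ts) \<in> Lam p"
    using *[of "\<lambda>_. c" 1] len list_all2_lengthD[OF rel] by simp
  moreover have "satisfies A (eps1 (Omega ss)) (eps1 (Omega ts))"
    using *[of _ 1] by (simp add: satisfies_def eps1_def)
  ultimately show "(Omega ss, Omega ts) \<in> fine_spectrum p A"
    by (simp add: fine_spectrum_def)
next
  fix s t :: bracketing and h :: "nat \<Rightarrow> bracketing"
  assume st: "(s, t) \<in> fine_spectrum p A" and h: "\<And>i. p_ary p (h i)"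
  have L: "(s, t) \<in> Lam p" and sat: "satisfies A (eps1 s) (eps1 t)"
    using st by (auto simp: fine_spectrum_def)
  \<comment> \<open>The first label of the block replacing x_i: after 1, skip the leaves of
    \<open>h 1\<close>, ..., \<open>h (i - 1)\<close>.\<close>
  define f where "f i = 1 + (\<Sum>j\<in>{1..<i}. leaves (h j))" for i
  have f: "f (Suc i) = f i + leaves (h i)" if "i \<ge> 1" for i
    using that by (simp add: f_def)
  have *: "eps1 (bind h (eps1 u)) = bind (\<lambda>i. label (f i) (h i)) (eps1 u)" for u
    using label_bind(1)[of f h 1 u, OF f] by (simp add: eps1_def f_def)
  have "evalt A g (bind (\<lambda>i. label (f i) (h i)) (eps1 s))
      = evalt A g (bind (\<lambda>i. label (f i) (h i)) (eps1 t))" if g: "range g \<subseteq> carrier A" for g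
  proof -
    have "range (\<lambda>i. evalt A g (label (f i) (h i))) \<subseteq> carrier A"
      using evalt_closed[OF A g] p_ary_label(1)[OF h] by auto
    then show ?thesis using sat unfolding evalt_bind satisfies_def by blast
  qed
  moreover have "(bind h (eps1 s), bind h (eps1 t)) \<in> Lam p"
    using L h by (rule Lam_bind)
  ultimately show "(bind h (eps1 s), bind h (eps1 t)) \<in> fine_spectrum p A"
    by (simp add: fine_spectrum_def satisfies_def *)
next
  show "fine_spectrum p A \<subseteq> Lam p" by (auto simp: fine_spectrum_def)
next
  fix s t u
  show "p_ary p s \<Longrightarrow> (s, s) \<in> fine_spectrum p A"
    by (simp add: fine_spectrum_def satisfies_def)
  show "(s, t) \<in> fine_spectrum p A \<Longrightarrow> (t, s) \<in> fine_spectrum p A"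
    by (simp add: fine_spectrum_def satisfies_def)
  show "(s, t) \<in> fine_spectrum p A \<Longrightarrow> (t, u) \<in> fine_spectrum p A \<Longrightarrow> (s, u) \<in> fine_spectrum p A"
    by (simp add: fine_spectrum_def satisfies_def)
qed

text \<open>The converse is completeness of equational logic: identities with the same variables in the
  same order on both sides only have consequences of that kind, so \<open>\<theta>\<close>, together with equality of
  the leaf words, is already a fully invariant congruence on all terms.\<close>

definition term_rel :: "nat \<Rightarrow> (bracketing \<times> bracketing) set \<Rightarrow> 'v pterm \<Rightarrow> 'v pterm \<Rightarrow> bool" where
  "term_rel p \<theta> u v \<longleftrightarrow> p_ary p u \<and> p_ary p v \<and> (shape u, shape v) \<in> \<theta> \<and> leaf_vars u = leaf_vars v"

lemma term_rel_Omega: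
  assumes "fine_congruence p \<theta>" "length us = p" "list_all2 (term_rel p \<theta>) us vs"
  shows "term_rel p \<theta> (Omega us) (Omega vs)"
proof -
  have "list_all2 (\<lambda>s t. (s, t) \<in> \<theta>) (map shape us) (map shape vs)"
    using assms(3) by (auto simp: list_all2_conv_all_nth term_rel_def)
  then have "(Omega (map shape us), Omega (map shape vs)) \<in> \<theta>"
    using fine_congruence_Omega[OF assms(1)] assms(2) by simp
  moreover have "map leaf_vars us = map leaf_vars vs"
    using assms(3) by (auto simp: list_all2_conv_all_nth term_rel_def intro!: nth_equalityI)
  moreover have "\<forall>u \<in> set us. p_ary p u" "\<forall>v \<in> set vs. p_ary p v" "length vs = p"
    using assms(2,3) by (auto simp: list_all2_conv_all_nth term_rel_def in_set_conv_nth)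
  ultimately show ?thesis using assms(2) by (simp add: term_rel_def)
qed

text \<open>The witness is the free algebra: terms over countably many variables modulo
  \<open>term_rel\<close>, realised on chosen representatives instead of classes.\<close>

lemma fine_congruence_in_FS:
  assumes \<theta>: "fine_congruence p \<theta>"
  shows "\<theta> \<in> FS p"
proof -
  let ?R = "term_rel p \<theta> :: nat pterm \<Rightarrow> nat pterm \<Rightarrow> bool"
  have R_refl: "?R u u" if "p_ary p u" for u
    using that fine_congruence_refl[OF \<theta>] by (simp add: term_rel_def)
  have R_sym: "?R v u" if "?R u v" for u v
    using that fine_congruence_sym[OF \<theta>] by (simp add: term_rel_def)
  have R_trans: "?R u w" if "?R u v" "?R v w" for u v w
    using that fine_congruence_trans[OF \<theta>] unfolding term_rel_def by metis
  define rep where "rep u = (SOME v. ?R u v)" for u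
  have rep: "?R u (rep u)" if "p_ary p u" for u
    unfolding rep_def using R_refl[OF that] by (rule someI)
  have rep_eq: "rep u = rep v" if "?R u v" for u v
  proof -
    have "?R u w = ?R v w" for w using that by (blast intro: R_sym R_trans)
    then show ?thesis by (simp add: rep_def)
  qed
  \<comment> \<open>Only terms of level 0 are related to a variable, and the leaf word then
    determines which one.\<close>
  have rep_Var: "rep (Var i) = Var i" for i
  proof -
    have *: "?R (Var i) (rep (Var i))" by (rule rep) simp
    then have "omegas (rep (Var i)) = 0"
      using fine_congruence_Lam[OF \<theta>] unfolding term_rel_def
      by (metis Lam_iff in_mono omegas.simps(1) omegas_map_pterm)
    then show ?thesis using * by (cases "rep (Var i)") (auto simp: term_rel_def)
  qed
  define F where "F = \<lparr>carrier = rep ` {u. p_ary p u}, oper = (\<lambda>us. rep (Omega us))\<rparr>"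
  have F_p_ary: "p_ary p u" and F_rep: "rep u = u" if u: "u \<in> carrier F" for u
  proof -
    obtain v where v: "p_ary p v" "u = rep v" using u by (auto simp: F_def)
    then show "p_ary p u" using rep by (auto simp: term_rel_def)
    show "rep u = u" using rep_eq[OF rep[OF v(1)]] v(2) by simp
  qed
  have F: "p_groupoid p F"
  proof -
    have "rep (Var 0) \<in> carrier F" by (simp add: F_def imageI)
    then have "carrier F \<noteq> {}" by blast
    moreover have "oper F us \<in> carrier F" if "length us = p" "set us \<subseteq> carrier F" for us
    proof -
      have "p_ary p (Omega us)" using that F_p_ary by auto
      then show ?thesis by (simp add: F_def)
    qed
    ultimately show ?thesis by (simp add: p_groupoid_def)
  qed
  \<comment> \<open>Evaluation in the quotient is substitution of representatives, up to
    \<open>term_rel\<close>.\<close>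
  have ev: "?R (evalt F h t) (bind h t)" if h: "range h \<subseteq> carrier F" and "p_ary p t" for h and t :: "nat pterm"
    using \<open>p_ary p t\<close>
  proof (induction t)
    case (Var v)
    then show ?case using h F_p_ary R_refl by (auto intro!: R_refl)
  next
    case (Omega ts)
    have "list_all2 ?R (map (evalt F h) ts) (map (bind h) ts)"
      using Omega by (auto simp: list_all2_conv_all_nth)
    then have *: "?R (Omega (map (evalt F h) ts)) (Omega (map (bind h) ts))"
      by (rule term_rel_Omega[OF \<theta>, rotated]) (use Omega.prems in simp)
    then have "p_ary p (Omega (map (evalt F h) ts))" by (simp add: term_rel_def)
    from R_trans[OF R_sym[OF rep[OF this]] *] show ?case by (simp add: F_def)
  qed
  have "(s, t) \<in> \<theta> \<longleftrightarrow> satisfies F (eps1 s) (eps1 t)" if L: "(s, t) \<in> Lam p" for s t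
  proof
    assume st: "(s, t) \<in> \<theta>"
    show "satisfies F (eps1 s) (eps1 t)"
      unfolding satisfies_def
    proof (intro allI impI)
      fix h :: "nat \<Rightarrow> nat pterm" assume h: "range h \<subseteq> carrier F"
      then have hp: "p_ary p (h i)" for i using F_p_ary by auto
      have "?R (bind h (eps1 s)) (bind h (eps1 t))"
        using fine_congruence_bind[OF \<theta> st, of "shape \<circ> h"] L hp leaf_vars_eps1[OF L]
        by (simp add: term_rel_def shape_bind p_ary_bind leaf_vars_bind)
      then have "?R (evalt F h (eps1 s)) (evalt F h (eps1 t))"
        using ev[OF h, of "eps1 s"] ev[OF h, of "eps1 t"] L R_sym R_trans
        by (metis Lam_iff p_ary_eps1_iff)
      then have "rep (evalt F h (eps1 s)) = rep (evalt F h (eps1 t))" by (rule rep_eq)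
      then show "evalt F h (eps1 s) = evalt F h (eps1 t)"
        using F_rep evalt_closed[OF F h] L by simp
    qed
  next
    assume sat: "satisfies F (eps1 s) (eps1 t)"
    \<comment> \<open>The generic assignment sends every variable to itself, so a satisfied identity
      already relates its two sides.\<close>
    have "Var i \<in> carrier F" for i
      using rep_Var[of i] unfolding F_def by (auto intro!: image_eqI[of _ _ "Var i"])
    then have h: "range Var \<subseteq> carrier F" by auto
    then have "evalt F Var (eps1 s) = evalt F Var (eps1 t)"
      using sat by (simp add: satisfies_def)
    then have "?R (eps1 s) (eps1 t)"
      using ev[OF h, of "eps1 s"] ev[OF h, of "eps1 t"] L R_sym R_trans
      by (metis Lam_iff p_ary_eps1_iff bind_Var)
    then show "(s, t) \<in> \<theta>" by (simp add: term_rel_def)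
  qed
  then have "fine_spectrum p F = \<theta>"
    using fine_congruence_Lam[OF \<theta>] by (auto simp: fine_spectrum_def)
  then show ?thesis using fine_spectrum_in_FS[OF F] by simp
qed

lemma FS_iff: "\<theta> \<in> FS p \<longleftrightarrow> fine_congruence p \<theta>"
  using fine_congruence_in_FS fine_congruence_fine_spectrum by (auto simp: FS_def)

section \<open>Restricting and extending fine congruences by level\<close>

lemma list_all2_subset_Lam:
  assumes "list_all2 (\<lambda>s t. (s, t) \<in> \<theta>) ss ts" "\<theta> \<subseteq> Lam p"
  shows "list_all2 (\<lambda>s t. (s, t) \<in> Lam p) ss ts"
  using assms(1) by (rule list_all2_mono) (use assms(2) in blast)

lemma omegas_nth_le: "i < length ss \<Longrightarrow> omegas (ss ! i) < omegas (Omega ss)"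
  using elem_le_sum_list[of i "map omegas ss"] by simp

text \<open>Different results arise only from different inputs; these lie above level
  \<open>n\<close>, and neither \<open>Omega\<close> nor substitution lowers the level.\<close>

lemma fine_congruence_restrict:
  assumes \<theta>: "fine_congruence p \<theta>"
  shows "fine_congruence p {(s, t) \<in> \<theta>. s = t \<or> n < omegas s}" (is "fine_congruence p ?R")
proof (rule fine_congruenceI)
  have L: "\<theta> \<subseteq> Lam p" by (rule fine_congruence_Lam[OF \<theta>])
  have eq: "omegas s = omegas t" if "(s, t) \<in> \<theta>" for s t using L that by auto
  show "?R \<subseteq> Lam p" using L by auto
  show "(s, s) \<in> ?R" if "p_ary p s" for s using fine_congruence_refl[OF \<theta> that] by simp
  show "(t, s) \<in> ?R" if "(s, t) \<in> ?R" for s t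
    using that fine_congruence_sym[OF \<theta>] eq by fastforce
  show "(s, u) \<in> ?R" if "(s, t) \<in> ?R" "(t, u) \<in> ?R" for s t u
    using that fine_congruence_trans[OF \<theta>] eq by fastforce
next
  fix ss ts assume len: "length ss = p" and rel: "list_all2 (\<lambda>s t. (s, t) \<in> ?R) ss ts"
  have "list_all2 (\<lambda>s t. (s, t) \<in> \<theta>) ss ts" using rel by (rule list_all2_mono) simp
  then have "(Omega ss, Omega ts) \<in> \<theta>" using fine_congruence_Omega[OF \<theta> len] by simp
  moreover have "n < omegas (Omega ss)" if ne: "ss \<noteq> ts"
  proof -
    obtain i where i: "i < length ss" "ss ! i \<noteq> ts ! i"
      using ne list_all2_lengthD[OF rel] nth_equalityI by blast
    then have "n < omegas (ss ! i)" using list_all2_nthD[OF rel i(1)] by simp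
    then show ?thesis using omegas_nth_le[OF i(1)] by simp
  qed
  ultimately show "(Omega ss, Omega ts) \<in> ?R" by auto
next
  fix s t :: bracketing and h :: "nat \<Rightarrow> bracketing"
  assume "(s, t) \<in> ?R" "\<And>i. p_ary p (h i)"
  then show "(bind h (eps1 s), bind h (eps1 t)) \<in> ?R"
    using fine_congruence_bind[OF \<theta>, of s t h] by (auto simp: omegas_bind)
qed

text \<open>If a result is not in \<theta>, then some input pair is not in \<theta> either. That
  pair lies above level \<open>n\<close>, hence so does the result.\<close>

lemma fine_congruence_extend:
  assumes \<theta>: "fine_congruence p \<theta>"
  shows "fine_congruence p {(s, t) \<in> Lam p. (s, t) \<in> \<theta> \<or> n < omegas s}"
    (is "fine_congruence p ?R")
proof (rule fine_congruenceI)
  have RL: "?R \<subseteq> Lam p" by auto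
  then show "?R \<subseteq> Lam p" .
  show "(s, s) \<in> ?R" if "p_ary p s" for s using fine_congruence_refl[OF \<theta> that] that by simp
  show "(t, s) \<in> ?R" if "(s, t) \<in> ?R" for s t
    using that fine_congruence_sym[OF \<theta>] by auto
  show "(s, u) \<in> ?R" if "(s, t) \<in> ?R" "(t, u) \<in> ?R" for s t u
    using that fine_congruence_trans[OF \<theta>] by auto
  fix ss ts assume len: "length ss = p" and rel: "list_all2 (\<lambda>s t. (s, t) \<in> ?R) ss ts"
  have "(Omega ss, Omega ts) \<in> Lam p"
    by (rule Lam_Omega[OF len list_all2_subset_Lam[OF rel RL]])
  moreover have "n < omegas (Omega ss)" if no: "(Omega ss, Omega ts) \<notin> \<theta>"
  proof -
    have "\<not> list_all2 (\<lambda>s t. (s, t) \<in> \<theta>) ss ts"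
      using no fine_congruence_Omega[OF \<theta> len] by blast
    then obtain i where i: "i < length ss" "(ss ! i, ts ! i) \<notin> \<theta>"
      using list_all2_lengthD[OF rel] by (auto simp: list_all2_conv_all_nth)
    then have "n < omegas (ss ! i)" using list_all2_nthD[OF rel i(1)] by simp
    then show ?thesis using omegas_nth_le[OF i(1)] by simp
  qed
  ultimately show "(Omega ss, Omega ts) \<in> ?R" by auto
next
  fix s t :: bracketing and h :: "nat \<Rightarrow> bracketing"
  assume st: "(s, t) \<in> ?R" and h: "\<And>i. p_ary p (h i)"
  then have "(bind h (eps1 s), bind h (eps1 t)) \<in> Lam p" by (intro Lam_bind) auto
  then show "(bind h (eps1 s), bind h (eps1 t)) \<in> ?R"
    using st h fine_congruence_bind[OF \<theta>, of s t h] by (auto simp: omegas_bind)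
qed

section \<open>The lowest levels\<close>

lemma omegas_eq_0: "omegas t = 0 \<longleftrightarrow> t = Var ()" for t :: bracketing
  by (cases t) auto

lemma omegas_eq_1:
  fixes t :: bracketing
  assumes "p_ary p t" "omegas t = 1"
  shows "t = Omega (replicate p (Var ()))"
proof (cases t)
  case (Omega ts)
  then have "length ts = p" "\<forall>u \<in> set ts. u = Var ()"
    using assms by (auto simp: omegas_eq_0[symmetric])
  then show ?thesis using Omega by (auto simp: replicate_length_same)
qed (use assms in simp)

text \<open>Levels 0 and 1 contain a single bracketing each.\<close>

lemma Lam_neq:
  assumes "(s, t) \<in> Lam p" "s \<noteq> t"
  shows "2 \<le> omegas s"
proof (rule ccontr)
  assume "\<not> 2 \<le> omegas s"
  then consider "omegas s = 0" | "omegas s = 1" by linarith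
  then show False
  proof cases
    case 1
    then show False using assms omegas_eq_0[of s] omegas_eq_0[of t] by simp
  next
    case 2
    then show False using assms omegas_eq_1[of p s] omegas_eq_1[of p t] by simp
  qed
qed

text \<open>The closure conditions put no constraint on level 2. Applying \<open>Omega\<close> to a
  non-trivial pair leads to level 3 or higher, and a substitution that keeps such a pair at level 2
  replaces leaves by leaves, so it returns the same pair.\<close>

lemma fine_congruence_level_2:
  assumes L: "R \<subseteq> Lam p" and refl: "\<And>s. p_ary p s \<Longrightarrow> (s, s) \<in> R"
    and sym: "\<And>s t. (s, t) \<in> R \<Longrightarrow> (t, s) \<in> R"
    and trans: "\<And>s t u. (s, t) \<in> R \<Longrightarrow> (t, u) \<in> R \<Longrightarrow> (s, u) \<in> R"
    and full: "\<And>s t. (s, t) \<in> Lam p \<Longrightarrow> omegas s \<noteq> 2 \<Longrightarrow> (s, t) \<in> R"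
  shows "fine_congruence p R"
proof (rule fine_congruenceI)
  fix ss ts assume len: "length ss = p" and rel: "list_all2 (\<lambda>s t. (s, t) \<in> R) ss ts"
  have O: "(Omega ss, Omega ts) \<in> Lam p"
    by (rule Lam_Omega[OF len list_all2_subset_Lam[OF rel L]])
  show "(Omega ss, Omega ts) \<in> R"
  proof (cases "ss = ts")
    case True
    then show ?thesis using O refl by simp
  next
    case False
    then obtain i where i: "i < length ss" "ss ! i \<noteq> ts ! i"
      using list_all2_lengthD[OF rel] nth_equalityI by blast
    then have "2 \<le> omegas (ss ! i)"
      using list_all2_nthD[OF rel i(1)] L by (intro Lam_neq) auto
    then show ?thesis using omegas_nth_le[OF i(1)] full[OF O] by simp
  qed
next
  fix s t :: bracketing and h :: "nat \<Rightarrow> bracketing"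
  assume st: "(s, t) \<in> R" and h: "\<And>i. p_ary p (h i)"
  have stL: "(s, t) \<in> Lam p" using st L by blast
  have B: "(bind h (eps1 s), bind h (eps1 t)) \<in> Lam p" using stL h by (rule Lam_bind)
  show "(bind h (eps1 s), bind h (eps1 t)) \<in> R"
  proof (cases "s \<noteq> t \<and> omegas (bind h (eps1 s)) = 2")
    case True
    then have "omegas s + sum_list (map (omegas \<circ> h) (leaf_vars (eps1 s))) = 2" "2 \<le> omegas s"
      using Lam_neq[OF stL] by (simp_all add: omegas_bind)
    then have "sum_list (map (omegas \<circ> h) (leaf_vars (eps1 s))) = 0" by linarith
    then have "\<forall>v \<in> set (leaf_vars (eps1 s)). omegas (h v) = 0" by simp
    then have "bind h (eps1 s) = s" "bind h (eps1 t) = t"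
      using bind_no_omegas[of "eps1 s" h] bind_no_omegas[of "eps1 t" h] leaf_vars_eps1[OF stL]
      by simp_all
    then show ?thesis using st by simp
  next
    case False
    then show ?thesis using full[OF B] B refl by auto
  qed
qed (use assms in blast)+


section \<open>Generalised associativity\<close>

text \<open>Children are counted from 0; the definition is used for \<open>i < p\<close>, where the
  outer node has p children.\<close>

definition inner_at :: "nat \<Rightarrow> nat \<Rightarrow> bracketing" where
  "inner_at p i = Omega (replicate i (Var ()) @ Omega (replicate p (Var ())) # replicate (p - Suc i) (Var ()))"

text \<open>A canonical member of each level: the normal form under generalised associativity, and
  the witness that no level is empty.\<close>

primrec left_comb :: "nat \<Rightarrow> nat \<Rightarrow> bracketing" where
  "left_comb p 0 = Var ()"
| "left_comb p (Suc n) = Omega (left_comb p n # replicate (p - 1) (Var ()))"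

lemma inner_at_bracketings_n: "i < p \<Longrightarrow> inner_at p i \<in> bracketings_n p 2"
  by (auto simp: inner_at_def bracketings_n_def sum_list_replicate)

lemma left_comb_bracketings_n: "p \<ge> 1 \<Longrightarrow> left_comb p n \<in> bracketings_n p n"
  by (induction n) (auto simp: bracketings_n_def sum_list_replicate)

text \<open>\<open>L\<close> lists the 2p - 1 terms put in place of the leaves. Labels start at 1,
  so entry \<open>j\<close> belongs to label \<open>Suc j\<close>; the inner node receives the p
  entries from position \<open>i\<close> on.\<close>

lemma bind_inner_at:
  assumes i: "i < p" and L: "Suc (length L) = 2 * p" and h: "\<And>j. j < length L \<Longrightarrow> h (Suc j) = L ! j"
  shows "bind h (eps1 (inner_at p i))
    = Omega (take i L @ Omega (take p (drop i L)) # drop (i + p) L)"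
proof -
  have *: "map h [Suc a..<Suc b] = take (b - a) (drop a L)" if "b \<le> length L" for a b
    using that h by (intro nth_equalityI) (auto simp del: upt_Suc)
  have len: "Suc (i + p + (p - Suc i)) = Suc (length L)" using i L by simp
  have "map h [Suc (i + p)..<Suc (i + p + (p - Suc i))] = drop (i + p) L"
    unfolding len using *[of "length L" "i + p"] by simp
  moreover have "map h [Suc 0..<Suc i] = take i L" using *[of i 0] i L by simp
  moreover have "map h [Suc i..<Suc (i + p)] = take p (drop i L)" using *[of "i + p" i] i L by simp
  moreover have "eps1 (inner_at p i) = Omega (map Var [Suc 0..<Suc i]
      @ Omega (map Var [Suc i..<Suc (i + p)]) # map Var [Suc (i + p)..<Suc (i + p + (p - Suc i))])"
    by (simp add: eps1_def inner_at_def labels_append labels_replicate sum_list_replicate del: upt_Suc)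
  ultimately show ?thesis by (simp add: comp_def del: upt_Suc)
qed

text \<open>Fullness at level 2 relates \<open>inner_at p i\<close> to \<open>inner_at p 0\<close>.
  Substituting the entries of \<open>L\<close> turns this into the law that moves an inner bracket
  to the front.\<close>

lemma rotate_inner:
  assumes \<theta>: "fine_congruence p \<theta>" and full: "bracketings_n p 2 \<times> bracketings_n p 2 \<subseteq> \<theta>"
    and i: "i < p" and L: "Suc (length L) = 2 * p" "\<forall>u \<in> set L. p_ary p u"
  shows "(Omega (take i L @ Omega (take p (drop i L)) # drop (i + p) L),
    Omega (Omega (take p L) # drop p L)) \<in> \<theta>"
proof -
  \<comment> \<open>The default \<open>Var ()\<close> concerns only labels that do not occur; it
    keeps all values of \<open>h\<close> p-ary.\<close>
  define h where "h j = (if 1 \<le> j \<and> j \<le> length L then L ! (j - 1) else Var ())" for j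
  have h: "h (Suc j) = L ! j" if "j < length L" for j using that by (simp add: h_def)
  have "p_ary p (h j)" for j using L(2) by (auto simp: h_def)
  moreover have "(inner_at p i, inner_at p 0) \<in> \<theta>"
    using full inner_at_bracketings_n i by fastforce
  ultimately have "(bind h (eps1 (inner_at p i)), bind h (eps1 (inner_at p 0))) \<in> \<theta>"
    using fine_congruence_bind[OF \<theta>] by blast
  moreover have "0 < p" using i by simp
  ultimately show ?thesis
    using bind_inner_at[OF i L(1) h] bind_inner_at[OF \<open>0 < p\<close> L(1) h] by simp
qed

text \<open>Rotating a non-trivial child into the first child keeps the number of \<open>\<omega>\<close>'s and enlarges the
  first child, so every bracketing ends up as a left comb.\<close>

lemma related_left_comb:
  assumes \<theta>: "fine_congruence p \<theta>" and p: "p \<ge> 1"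
    and full: "bracketings_n p 2 \<times> bracketings_n p 2 \<subseteq> \<theta>"
  shows "p_ary p t \<Longrightarrow> (t, left_comb p (omegas t)) \<in> \<theta>"
proof (induction "omegas t" arbitrary: t rule: less_induct)
  case outer: less
  \<comment> \<open>The outer induction is on the level, this inner one on the number of
    \<open>Omega\<close> nodes outside the first child.\<close>
  have inner: "(Omega (t1 # ts), left_comb p (omegas t)) \<in> \<theta>"
    if "p_ary p (Omega (t1 # ts))" "omegas (Omega (t1 # ts)) = omegas t" for t1 ts
    using that
  proof (induction "sum_list (map omegas ts)" arbitrary: t1 ts rule: less_induct)
    case less
    show ?case
    proof (cases "\<forall>u \<in> set ts. u = Var ()")
      \<comment> \<open>All later children are leaves, so \<open>t1\<close> is one level below
        \<open>t\<close> and the outer hypothesis turns it into a comb.\<close>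
      case True
      then have ts: "ts = replicate (p - 1) (Var ())"
        using less.prems(1) by (auto simp: replicate_length_same)
      then have om: "omegas t = Suc (omegas t1)" using less.prems(2) by (simp add: sum_list_replicate)
      then have "(t1, left_comb p (omegas t1)) \<in> \<theta>" using outer(1)[of t1] less.prems(1) by simp
      moreover have "list_all2 (\<lambda>s t. (s, t) \<in> \<theta>) ts ts"
        using less.prems(1) fine_congruence_refl[OF \<theta>] by (simp add: list_all2_same)
      ultimately have "(Omega (t1 # ts), Omega (left_comb p (omegas t1) # ts)) \<in> \<theta>"
        using less.prems(1) by (intro fine_congruence_Omega[OF \<theta>]) auto
      then show ?thesis using om ts by simp
    next
      case False
      then obtain u where u: "u \<in> set ts" "u \<noteq> Var ()" by blast
      obtain us where "u = Omega us" using u(2) by (cases u) auto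
      with u(1) obtain xs ys where ts: "ts = xs @ Omega us # ys" by (meson split_list)
      \<comment> \<open>The children of the node, with one non-trivial child opened up: (p - 1) + p
        entries. That child has index \<open>Suc (length xs)\<close>, as \<open>t1\<close> precedes
        \<open>xs\<close>.\<close>
      define L where "L = t1 # xs @ us @ ys"
      have L: "Suc (length L) = 2 * p" "\<forall>u \<in> set L. p_ary p u"
        using less.prems(1) by (auto simp: L_def ts)
      have us: "length us = p" and i: "Suc (length xs) < p"
        using less.prems(1) by (auto simp: ts)
      have "(Omega (t1 # ts), Omega (Omega (take p L) # drop p L)) \<in> \<theta>" (is "(_, ?t) \<in> _")
        using rotate_inner[OF \<theta> full i L] us by (simp add: L_def ts)
      moreover from this have t': "p_ary p ?t" "omegas ?t = omegas t"
        using fine_congruence_Lam[OF \<theta>] less.prems(2) by auto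
      \<comment> \<open>The level is unchanged, while the new first child contains \<open>t1\<close>
        below a further \<open>Omega\<close>, so fewer are left for the others.\<close>
      moreover have "sum_list (map omegas (drop p L)) < sum_list (map omegas ts)"
      proof -
        have "omegas t1 \<le> sum_list (map omegas (take p L))"
          using p by (cases p) (auto simp: L_def)
        then show ?thesis using t'(2) less.prems(2) by simp
      qed
      ultimately show ?thesis
        using less.hyps[of "drop p L" "Omega (take p L)"] fine_congruence_trans[OF \<theta>] by blast
    qed
  qed
  show ?case
  proof (cases t)
    case (Var u)
    then show ?thesis using fine_congruence_refl[OF \<theta>, of "Var ()"] by simp
  next
    case (Omega ts)
    then obtain t1 ts' where "ts = t1 # ts'" using outer.prems p by (cases ts) auto
    then show ?thesis using inner outer.prems Omega by metis
  qed
qed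

text \<open>Bracketings of the same level are related to the same left comb.\<close>

lemma level_2_full_imp_Lam:
  assumes \<theta>: "fine_congruence p \<theta>" and "p \<ge> 1"
    and "bracketings_n p 2 \<times> bracketings_n p 2 \<subseteq> \<theta>"
  shows "\<theta> = Lam p"
proof (rule antisym[OF fine_congruence_Lam[OF \<theta>]], clarify)
  fix s t assume "(s, t) \<in> Lam p"
  then show "(s, t) \<in> \<theta>"
    using related_left_comb[OF assms, of s] related_left_comb[OF assms, of t]
      fine_congruence_sym[OF \<theta>] fine_congruence_trans[OF \<theta>] by (metis Lam_iff)
qed

section \<open>Spectra, atoms and coatoms\<close>

lemma card_quotient_1:
  assumes eq: "equiv B R" and ne: "B \<noteq> {}"
  shows "card (B // R) = 1 \<longleftrightarrow> B \<times> B \<subseteq> R"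
proof
  assume "card (B // R) = 1"
  then obtain X where X: "B // R = {X}" by (rule card_1_singletonE)
  show "B \<times> B \<subseteq> R"
  proof clarify
    fix x y assume xy: "x \<in> B" "y \<in> B"
    then have "R `` {x} \<in> {X}" "R `` {y} \<in> {X}" unfolding X[symmetric] by (blast intro: quotientI)+
    then show "(x, y) \<in> R" using eq_equiv_class[OF _ eq xy(2)] by simp
  qed
next
  assume "B \<times> B \<subseteq> R"
  then have "R `` {x} = B" if "x \<in> B" for x
    using that eq unfolding equiv_def by blast
  then have "B // R = {B}" using ne by (auto simp: quotient_def)
  then show "card (B // R) = 1" by simp
qed

text \<open>Two classes amount to two unrelated representatives whose classes cover
  \<open>B\<close>; this form speaks of pairs only, as the coatom criterion does.\<close>

lemma card_quotient_2:
  assumes eq: "equiv B R"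
  shows "card (B // R) = 2 \<longleftrightarrow>
    (\<exists>s \<in> B. \<exists>t \<in> B. (s, t) \<notin> R \<and> (\<forall>u \<in> B. (s, u) \<in> R \<or> (t, u) \<in> R))"
proof
  assume "card (B // R) = 2"
  then obtain X Y where XY: "B // R = {X, Y}" "X \<noteq> Y" by (auto simp: card_2_iff)
  obtain s where s: "s \<in> B" "X = R `` {s}" using XY(1) by (metis insertI1 quotientE)
  obtain t where t: "t \<in> B" "Y = R `` {t}" using XY(1) by (metis insertI1 insertI2 quotientE)
  have "(s, t) \<notin> R" using XY(2) s t equiv_class_eq[OF eq] by metis
  moreover have "(s, u) \<in> R \<or> (t, u) \<in> R" if u: "u \<in> B" for u
  proof -
    have "R `` {u} \<in> {X, Y}" unfolding XY(1)[symmetric] using u by (rule quotientI)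
    then show ?thesis using s(2) t(2) eq_equiv_class[OF _ eq u] by auto
  qed
  ultimately show "\<exists>s \<in> B. \<exists>t \<in> B. (s, t) \<notin> R \<and> (\<forall>u \<in> B. (s, u) \<in> R \<or> (t, u) \<in> R)"
    using s t by blast
next
  assume "\<exists>s \<in> B. \<exists>t \<in> B. (s, t) \<notin> R \<and> (\<forall>u \<in> B. (s, u) \<in> R \<or> (t, u) \<in> R)"
  then obtain s t where st: "s \<in> B" "t \<in> B" "(s, t) \<notin> R"
    and cov: "\<And>u. u \<in> B \<Longrightarrow> (s, u) \<in> R \<or> (t, u) \<in> R" by blast
  have "R `` {u} \<in> {R `` {s}, R `` {t}}" if "u \<in> B" for u
    using cov[OF that] equiv_class_eq[OF eq] by blast
  then have "B // R = {R `` {s}, R `` {t}}"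
    using st by (auto simp: quotient_def)
  moreover have "R `` {s} \<noteq> R `` {t}" using st eq_equiv_class[OF _ eq] by metis
  ultimately show "card (B // R) = 2" by simp
qed

lemma equiv_fine_spectrum_n:
  assumes "p_groupoid p A"
  shows "equiv (bracketings_n p n) (fine_spectrum_n p A n)"
proof -
  have "equiv (bracketings p) (fine_spectrum p A)"
    using fine_congruence_equiv[OF fine_congruence_fine_spectrum[OF assms]] .
  then show ?thesis
    unfolding equiv_def refl_on_def sym_def trans_def fine_spectrum_n_def bracketings_n_def
    by blast
qed

lemma assoc_spectrum_eq_1:
  assumes "p_groupoid p A" "p \<ge> 1"
  shows "assoc_spectrum p A n = 1 \<longleftrightarrow> bracketings_n p n \<times> bracketings_n p n \<subseteq> fine_spectrum p A"
proof -
  have "bracketings_n p n \<noteq> {}" using left_comb_bracketings_n[OF assms(2)] by blast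
  from card_quotient_1[OF equiv_fine_spectrum_n[OF assms(1)] this] show ?thesis
    unfolding assoc_spectrum_def by (auto simp: fine_spectrum_n_def)
qed

lemma assoc_spectrum_eq_2:
  assumes "p_groupoid p A"
  shows "assoc_spectrum p A n = 2 \<longleftrightarrow>
    (\<exists>s \<in> bracketings_n p n. \<exists>t \<in> bracketings_n p n. (s, t) \<notin> fine_spectrum p A \<and>
      (\<forall>u \<in> bracketings_n p n. (s, u) \<in> fine_spectrum p A \<or> (t, u) \<in> fine_spectrum p A))"
  unfolding assoc_spectrum_def card_quotient_2[OF equiv_fine_spectrum_n[OF assms]]
  by (simp add: fine_spectrum_n_def cong: bex_cong)

section \<open>Top, bottom and covering in the lattice\<close>

lemma top_FS: "\<top>\<^bsub>FS_order p\<^esub> = Lam p"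
proof -
  interpret complete_lattice "FS_order p" by (rule FS_complete_lattice)
  have "Lam p \<sqsubseteq>\<^bsub>FS_order p\<^esub> \<top>\<^bsub>FS_order p\<^esub>"
    by (rule top_higher) (simp add: FS_order_def Lam_in_FS)
  then show ?thesis using top_closed FS_subset_Lam by (auto simp: FS_order_def)
qed

lemma Id_on_in_FS: "Id_on (bracketings p) \<in> FS p"
proof -
  have "ss = ts" if "list_all2 (\<lambda>s t. (s, t) \<in> Id_on (bracketings p)) ss ts" for ss ts
    using list_all2_mono[OF that, of "(=)"] by (auto simp: list.rel_eq)
  moreover have "s \<in> bracketings p" if "s \<in> set ss"
    "list_all2 (\<lambda>s t. (s, t) \<in> Id_on (bracketings p)) ss ts" for s ss ts
    using that by (auto simp: list_all2_conv_all_nth in_set_conv_nth Id_on_def)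
  ultimately show ?thesis
    unfolding FS_iff by (intro fine_congruenceI) (auto simp: p_ary_bind Id_on_def)
qed

text \<open>One inclusion is leastness, the other is reflexivity of fine congruences.\<close>

lemma bottom_FS: "\<bottom>\<^bsub>FS_order p\<^esub> = Id_on (bracketings p)"
proof -
  interpret complete_lattice "FS_order p" by (rule FS_complete_lattice)
  have "\<bottom>\<^bsub>FS_order p\<^esub> \<sqsubseteq>\<^bsub>FS_order p\<^esub> Id_on (bracketings p)"
    by (rule bottom_lower) (simp add: FS_order_def Id_on_in_FS)
  moreover have "\<bottom>\<^bsub>FS_order p\<^esub> \<in> FS p" using bottom_closed by (simp add: FS_order_def)
  ultimately show ?thesis
    using fine_congruence_refl by (auto simp: FS_order_def FS_iff)
qed

lemma covers_FS:
  "covers (FS_order p) a b \<longleftrightarrow>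
    a \<in> FS p \<and> b \<in> FS p \<and> b \<subset> a \<and> \<not> (\<exists>c \<in> FS p. b \<subset> c \<and> c \<subset> a)"
  by (simp add: covers_def lless_def FS_order_def psubset_eq)

section \<open>Absence of atoms\<close>

lemma no_atoms:
  assumes p: "p \<ge> 1"
  shows "\<not> atom (FS_order p) \<theta>"
proof
  assume at: "atom (FS_order p) \<theta>"
  then have \<theta>: "fine_congruence p \<theta>"
    and min: "\<And>c. c \<in> FS p \<Longrightarrow> Id_on (bracketings p) \<subset> c \<Longrightarrow> c \<subset> \<theta> \<Longrightarrow> False"
    and ne: "Id_on (bracketings p) \<subset> \<theta>"
    by (auto simp: atom_def bottom_FS covers_FS FS_iff)
  obtain s t where st: "(s, t) \<in> \<theta>" "(s, t) \<notin> Id_on (bracketings p)"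
    using ne by (auto simp: psubset_eq)
  have L: "(s, t) \<in> Lam p" using st(1) fine_congruence_Lam[OF \<theta>] by blast
  then have "s \<noteq> t" using st(2) by auto
  \<comment> \<open>This cut removes the pair \<open>(s, t)\<close> itself, so \<open>c\<close> is
    strictly below \<theta>.\<close>
  define c where "c = {(u, v) \<in> \<theta>. u = v \<or> omegas s < omegas u}"
  have c: "c \<in> FS p" unfolding FS_iff c_def by (rule fine_congruence_restrict[OF \<theta>])
  \<comment> \<open>One more \<open>Omega\<close>, padded with leaves, lifts \<open>(s, t)\<close>
    to a non-trivial pair one level higher, which survives in \<open>c\<close>.\<close>
  let ?xs = "replicate (p - 1) (Var ())"
  have "list_all2 (\<lambda>s t. (s, t) \<in> \<theta>) (s # ?xs) (t # ?xs)"
    using st(1) fine_congruence_refl[OF \<theta>, of "Var ()"] by (simp add: list_all2_same)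
  then have "(Omega (s # ?xs), Omega (t # ?xs)) \<in> \<theta>"
    using p by (intro fine_congruence_Omega[OF \<theta>]) auto
  then have "(Omega (s # ?xs), Omega (t # ?xs)) \<in> c" by (simp add: c_def)
  moreover have "Id_on (bracketings p) \<subseteq> c"
    using c fine_congruence_refl by (auto simp: FS_iff)
  ultimately have Id: "Id_on (bracketings p) \<subset> c" using \<open>s \<noteq> t\<close> by (auto simp: psubset_eq)
  have "(s, t) \<notin> c" using \<open>s \<noteq> t\<close> by (simp add: c_def)
  moreover have "c \<subseteq> \<theta>" by (auto simp: c_def)
  ultimately have "c \<subset> \<theta>" using st(1) by blast
  then show False by (rule min[OF c Id])
qed

section \<open>Characterisation of the coatoms\<close>

lemma Lam_level: "(s, t) \<in> Lam p \<longleftrightarrow> (\<exists>n. s \<in> bracketings_n p n \<and> t \<in> bracketings_n p n)"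
  by (auto simp: bracketings_n_def)

lemma coatom_FS_iff:
  "coatom (FS_order p) \<theta> \<longleftrightarrow> fine_congruence p \<theta> \<and> \<theta> \<subset> Lam p \<and>
    (\<forall>c. fine_congruence p c \<and> \<theta> \<subset> c \<longrightarrow> c = Lam p)"
proof -
  have "fine_congruence p (Lam p)" using Lam_in_FS FS_iff by blast
  moreover have "c \<subset> Lam p \<longleftrightarrow> c \<noteq> Lam p" if "fine_congruence p c" for c
    using fine_congruence_Lam[OF that] by blast
  ultimately show ?thesis
    unfolding coatom_def top_FS covers_FS Bex_def FS_iff by blast
qed

lemma coatom_FS:
  assumes p: "p \<ge> 1" and \<theta>: "fine_congruence p \<theta>"
  shows "coatom (FS_order p) \<theta> \<longleftrightarrow>
    (\<forall>n. n \<noteq> 2 \<longrightarrow> bracketings_n p n \<times> bracketings_n p n \<subseteq> \<theta>) \<and>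
    (\<exists>s \<in> bracketings_n p 2. \<exists>t \<in> bracketings_n p 2. (s, t) \<notin> \<theta> \<and>
      (\<forall>u \<in> bracketings_n p 2. (s, u) \<in> \<theta> \<or> (t, u) \<in> \<theta>))"
    (is "?L \<longleftrightarrow> ?full \<and> ?two")
proof
  have L: "\<theta> \<subseteq> Lam p" by (rule fine_congruence_Lam[OF \<theta>])
  assume ?L
  then have ne: "\<theta> \<noteq> Lam p"
    and max: "\<And>c. fine_congruence p c \<Longrightarrow> \<theta> \<subseteq> c \<Longrightarrow> c \<noteq> \<theta> \<Longrightarrow> c = Lam p"
    by (simp_all add: coatom_FS_iff psubset_eq)
  \<comment> \<open>Adding all pairs above a level that is not full leaves that level not full. The
    extension is therefore not the top, so by maximality it adds nothing.\<close>
  have above: "(s, t) \<in> \<theta>" if n: "\<not> bracketings_n p n \<times> bracketings_n p n \<subseteq> \<theta>"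
    and st: "(s, t) \<in> Lam p" "n < omegas s" for n s t
  proof (rule ccontr)
    assume no: "(s, t) \<notin> \<theta>"
    define c where "c = {(s, t) \<in> Lam p. (s, t) \<in> \<theta> \<or> n < omegas s}"
    have "(s, t) \<in> c" using st by (simp add: c_def)
    then have "c \<noteq> \<theta>" using no by blast
    moreover have "\<theta> \<subseteq> c" using L by (auto simp: c_def)
    moreover have "fine_congruence p c" unfolding c_def by (rule fine_congruence_extend[OF \<theta>])
    ultimately have "c = Lam p" using max by blast
    moreover obtain u v where "u \<in> bracketings_n p n" "v \<in> bracketings_n p n" "(u, v) \<notin> \<theta>"
      using n by blast
    moreover from this have "(u, v) \<in> Lam p" "(u, v) \<notin> c"
      by (simp_all add: c_def bracketings_n_def)
    ultimately show False by simp
  qed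
  have n2: "\<not> bracketings_n p 2 \<times> bracketings_n p 2 \<subseteq> \<theta>"
    using level_2_full_imp_Lam[OF \<theta> p] ne by blast
  have full: "(s, t) \<in> \<theta>" if st: "(s, t) \<in> Lam p" "omegas s \<noteq> 2" for s t
  proof (cases "s = t")
    case True
    then show ?thesis using st fine_congruence_refl[OF \<theta>] by simp
  next
    case False
    then have "2 < omegas s" using Lam_neq[OF st(1)] st(2) by simp
    then show ?thesis by (rule above[OF n2 st(1)])
  qed
  have ?full using full by (auto simp: bracketings_n_def)
  moreover have ?two
  proof -
    obtain s t where s: "s \<in> bracketings_n p 2" and t: "t \<in> bracketings_n p 2" and st: "(s, t) \<notin> \<theta>"
      using n2 by blast
    have sp: "p_ary p s" "omegas s = 2" and tp: "p_ary p t" "omegas t = 2"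
      using s t by (auto simp: bracketings_n_def)
    \<comment> \<open>The union of the classes of \<open>s\<close> and \<open>t\<close>. Below,
      \<open>c\<close> merges these two classes; since it is full off level 2, being an equivalence
      suffices, and maximality makes it the top.\<close>
    define M where "M = {u. (s, u) \<in> \<theta> \<or> (t, u) \<in> \<theta>}"
    have stM: "s \<in> M" "t \<in> M" using sp tp fine_congruence_refl[OF \<theta>] by (auto simp: M_def)
    have MLam: "p_ary p u \<and> omegas u = 2" if "u \<in> M" for u
      using that L sp tp by (auto simp: M_def)
    have M_closed: "v \<in> M" if "u \<in> M" "(u, v) \<in> \<theta>" for u v
      using that fine_congruence_trans[OF \<theta>] unfolding M_def by blast
    define c where "c = \<theta> \<union> M \<times> M"
    have "fine_congruence p c"
    proof (rule fine_congruence_level_2)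
      show "c \<subseteq> Lam p" using L MLam by (auto simp: c_def)
      show "(u, u) \<in> c" if "p_ary p u" for u
        using fine_congruence_refl[OF \<theta> that] by (simp add: c_def)
      show "(v, u) \<in> c" if "(u, v) \<in> c" for u v
        using that fine_congruence_sym[OF \<theta>] by (auto simp: c_def)
      show "(u, w) \<in> c" if "(u, v) \<in> c" "(v, w) \<in> c" for u v w
        using that fine_congruence_trans[OF \<theta>] fine_congruence_sym[OF \<theta>] M_closed
        unfolding c_def by blast
      show "(u, v) \<in> c" if "(u, v) \<in> Lam p" "omegas u \<noteq> 2" for u v
        using full[OF that] by (simp add: c_def)
    qed
    moreover have "(s, t) \<in> c" using stM by (simp add: c_def)
    then have "c \<noteq> \<theta>" using st by blast
    ultimately have c: "c = Lam p" using max[of c] by (simp add: c_def)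
    have "(s, u) \<in> \<theta> \<or> (t, u) \<in> \<theta>" if "u \<in> bracketings_n p 2" for u
    proof -
      have "(s, u) \<in> Lam p" using that sp by (auto simp: bracketings_n_def)
      then show ?thesis unfolding c[symmetric] c_def M_def by blast
    qed
    then show ?thesis using s t st by blast
  qed
  ultimately show "?full \<and> ?two" ..
next
  assume "?full \<and> ?two"
  then obtain s t where full: "\<And>n. n \<noteq> 2 \<Longrightarrow> bracketings_n p n \<times> bracketings_n p n \<subseteq> \<theta>"
    and s: "s \<in> bracketings_n p 2" and t: "t \<in> bracketings_n p 2" and st: "(s, t) \<notin> \<theta>"
    and cov: "\<And>u. u \<in> bracketings_n p 2 \<Longrightarrow> (s, u) \<in> \<theta> \<or> (t, u) \<in> \<theta>" by blast
  have L: "\<theta> \<subseteq> Lam p" by (rule fine_congruence_Lam[OF \<theta>])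
  have "(s, t) \<in> Lam p" using s t Lam_level by blast
  then have "\<theta> \<subset> Lam p" using L st by blast
  moreover have "c = Lam p" if c: "fine_congruence p c" and "\<theta> \<subset> c" for c
  proof -
    note sym = fine_congruence_sym[OF c] and trans = fine_congruence_trans[OF c]
    obtain u v where uv: "(u, v) \<in> c" "(u, v) \<notin> \<theta>" using \<open>\<theta> \<subset> c\<close> by auto
    obtain n where n: "u \<in> bracketings_n p n" "v \<in> bracketings_n p n"
      using uv(1) fine_congruence_Lam[OF c] Lam_level by blast
    then have [simp]: "n = 2" using full[of n] uv(2) by blast
    have sub: "\<And>x y. (x, y) \<in> \<theta> \<Longrightarrow> (x, y) \<in> c" using \<open>\<theta> \<subset> c\<close> by blast
    \<comment> \<open>The unrelated \<open>u\<close> and \<open>v\<close> lie in different classes,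
      one with \<open>s\<close> and the other with \<open>t\<close>, so relating them in
      \<open>c\<close> relates \<open>s\<close> to \<open>t\<close>.\<close>
    have "\<not> ((x, u) \<in> \<theta> \<and> (x, v) \<in> \<theta>)" for x
      using uv(2) fine_congruence_sym[OF \<theta>] fine_congruence_trans[OF \<theta>] by blast
    moreover have "(s, u) \<in> \<theta> \<or> (t, u) \<in> \<theta>" "(s, v) \<in> \<theta> \<or> (t, v) \<in> \<theta>"
      using cov n by auto
    ultimately consider "(s, u) \<in> \<theta>" "(t, v) \<in> \<theta>" | "(t, u) \<in> \<theta>" "(s, v) \<in> \<theta>" by blast
    then have "(s, t) \<in> c"
    proof cases
      case 1
      show ?thesis by (rule trans[OF sub[OF 1(1)] trans[OF uv(1) sym[OF sub[OF 1(2)]]]])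
    next
      case 2
      show ?thesis by (rule trans[OF sub[OF 2(2)] trans[OF sym[OF uv(1)] sym[OF sub[OF 2(1)]]]])
    qed
    then have sw: "(s, w) \<in> c" if "w \<in> bracketings_n p 2" for w
      using cov[OF that] sub trans by blast
    have "bracketings_n p 2 \<times> bracketings_n p 2 \<subseteq> c"
      using trans[OF sym[OF sw] sw] by auto
    then show ?thesis by (rule level_2_full_imp_Lam[OF c p])
  qed
  ultimately show ?L
    using \<theta> by (simp add: coatom_FS_iff)
qed

theorem corollary6p2:
  fixes p :: nat
  assumes "p \<ge> 2"
  shows "(\<not> (\<exists>\<theta>. atom (FS_order p) \<theta>)) \<and>
    (\<forall>A :: 'a groupoid. p_groupoid p A \<longrightarrow>
      fine_spectrum p A \<in> FS p \<and>
      (coatom (FS_order p) (fine_spectrum p A) \<longleftrightarrow>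
        (\<forall>n. n \<noteq> 2 \<longrightarrow> assoc_spectrum p A n = 1) \<and> assoc_spectrum p A 2 = 2))"
proof (intro conjI allI impI)
  show "\<not> (\<exists>\<theta>. atom (FS_order p) \<theta>)" using no_atoms assms by simp
next
  fix A :: "'a groupoid" assume A: "p_groupoid p A"
  have p: "p \<ge> 1" using assms by simp
  show "fine_spectrum p A \<in> FS p" by (rule fine_spectrum_in_FS[OF A])
  show "coatom (FS_order p) (fine_spectrum p A) \<longleftrightarrow>
    (\<forall>n. n \<noteq> 2 \<longrightarrow> assoc_spectrum p A n = 1) \<and> assoc_spectrum p A 2 = 2"
    unfolding coatom_FS[OF p fine_congruence_fine_spectrum[OF A]]
      assoc_spectrum_eq_1[OF A p] assoc_spectrum_eq_2[OF A] ..
qed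

end
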